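(* Let $$F=\frac1{\sqrt2}\begin{pmatrix}1&1\\1&-1\end{pmatrix},\qquad R=\begin{pmatrix}1&0\\0&-i\end{pmatrix},\qquad Z=e^{2\pi i/24}RF,$$ and let $G_{11}=\langle F,R,Z\rangle\subset U(\mathbb{C}^2)$. There is a surjective homomorphism $\Psi:G_{11}\to S_4$ given by $$F\mapsto(1\,4),\qquad R\mapsto(1\,2\,3\,4),\qquad Z\mapsto(2\,3\,4),$$ whose quotient is an isomorphism from the collineation group of $G_{11}$ to $S_4$. In particular, the collineation group of a subgroup $H\subset G_{11}$ is isomorphic to $\Psi(H)\subset S_4$.
   Context: The group $\langle F,R,Z\rangle$ is (a copy of) the Shephard–Todd complex reflection group $G_{11}$, of order $576$ with centre of order $24$. The collineation group of a group of matrices is the group factored by its subgroup of scalar matrices. Permutations are composed right to left. *)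

theory Defs
  imports "HOL-Analysis.Analysis" "HOL-Algebra.Algebra"
begin

definition conj_transpose :: "complex^'n^'m \<Rightarrow> complex^'m^'n" where
  "conj_transpose A = (\<chi> i j. cnj (A $ j $ i))"

definition unitary_group :: "(complex^2^2) monoid" where
  "unitary_group =
     \<lparr>carrier = {A. conj_transpose A ** A = mat 1}, mult = (**), one = mat 1\<rparr>"

definition matF :: "complex^2^2" where
  "matF = (1 / sqrt 2) *\<^sub>R vector [vector [1, 1], vector [1, -1]]"

definition matR :: "complex^2^2" where
  "matR = vector [vector [1, 0], vector [0, -\<i>]]"

(* mat c is the scalar matrix c I *)
definition matZ :: "complex^2^2" where
  "matZ = mat (exp (2 * complex_of_real pi * \<i> / 24)) ** (matR ** matF)"

definition G11 :: "(complex^2^2) monoid" where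
  "G11 = subgroup_generated unitary_group {matF, matR, matZ}"

definition scalar_matrices :: "(complex^2^2) monoid \<Rightarrow> (complex^2^2) set" where
  "scalar_matrices G = {A \<in> carrier G. \<exists>c. A = mat c}"

definition collineation_group :: "(complex^2^2) monoid \<Rightarrow> (complex^2^2) set monoid" where
  "collineation_group G = G Mod scalar_matrices G"

(* subgroup_generated intersects the generating set with the carrier of the group and
   Mod is a group only for a normal subgroup, hence the following facts. *)

lemma unitary_group_is_group: "group unitary_group"
proof (rule groupI)
  fix A B assume "A \<in> carrier unitary_group" "B \<in> carrier unitary_group"
  then have A: "conj_transpose A ** A = mat 1" and B: "conj_transpose B ** B = mat 1"
    by (simp_all add: unitary_group_def)
  have "conj_transpose (A ** B) = conj_transpose B ** conj_transpose A"
    by (simp add: conj_transpose_def matrix_matrix_mult_def vec_eq_iff mult.commute)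
  then have "conj_transpose (A ** B) ** (A ** B)
      = conj_transpose B ** (conj_transpose A ** A) ** B"
    by (simp add: matrix_mul_assoc)
  then show "A \<otimes>\<^bsub>unitary_group\<^esub> B \<in> carrier unitary_group"
    using A B by (simp add: unitary_group_def)
next
  fix A assume "A \<in> carrier unitary_group"
  then have A: "conj_transpose A ** A = mat 1"
    by (simp add: unitary_group_def)
  have "conj_transpose (conj_transpose A) = A"
    by (simp add: conj_transpose_def vec_eq_iff)
  then have "conj_transpose A \<in> carrier unitary_group"
    using A by (simp add: unitary_group_def matrix_left_right_inverse)
  then show "\<exists>B\<in>carrier unitary_group. B \<otimes>\<^bsub>unitary_group\<^esub> A = \<one>\<^bsub>unitary_group\<^esub>"
    using A by (auto simp: unitary_group_def)
next
  have "conj_transpose (mat 1) = (mat 1 :: complex^2^2)"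
    by (simp add: conj_transpose_def mat_def vec_eq_iff)
  then show "\<one>\<^bsub>unitary_group\<^esub> \<in> carrier unitary_group"
    by (simp add: unitary_group_def)
qed (auto simp: unitary_group_def matrix_mul_assoc)

lemma generators_unitary: "{matF, matR, matZ} \<subseteq> carrier unitary_group"
proof -
  have entries: "matF $ 1 $ 1 = of_real (1 / sqrt 2)" "matF $ 1 $ 2 = of_real (1 / sqrt 2)"
      "matF $ 2 $ 1 = of_real (1 / sqrt 2)" "matF $ 2 $ 2 = - of_real (1 / sqrt 2)"
    by (simp_all add: matF_def vector_2 scaleR_conv_of_real[where 'a = complex])
  have "complex_of_real (1 / sqrt 2) * of_real (1 / sqrt 2) = 1 / 2"
    by (simp flip: of_real_mult)
  then have F: "matF \<in> carrier unitary_group"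
    by (simp add: unitary_group_def conj_transpose_def mat_def
        matrix_matrix_mult_def vec_eq_iff sum_2 forall_2 entries mult.commute del: of_real_divide)
  have R: "matR \<in> carrier unitary_group"
    by (simp add: unitary_group_def matR_def conj_transpose_def mat_def
        matrix_matrix_mult_def vec_eq_iff sum_2 forall_2 vector_2)
  have "cnj (exp (2 * complex_of_real pi * \<i> / 24)) * exp (2 * complex_of_real pi * \<i> / 24) = 1"
    by (simp add: exp_cnj flip: exp_add)
  then have "mat (exp (2 * complex_of_real pi * \<i> / 24)) \<in> carrier unitary_group"
    by (simp add: unitary_group_def conj_transpose_def mat_def
        matrix_matrix_mult_def vec_eq_iff sum_2 forall_2)
  with F R have "matZ \<in> carrier unitary_group"
    using group.is_monoid[OF unitary_group_is_group, THEN monoid.m_closed]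
    by (simp add: matZ_def unitary_group_def)
  with F R show ?thesis by blast
qed

lemma G11_is_group: "group G11"
  unfolding G11_def by (rule group.group_subgroup_generated[OF unitary_group_is_group])

lemma carrier_G11: "carrier G11 = generate unitary_group {matF, matR, matZ}"
  using generators_unitary
  by (simp add: G11_def carrier_subgroup_generated Int_absorb1)

lemma scalar_matrices_normal:
  assumes "subgroup H unitary_group"
  shows "scalar_matrices (unitary_group\<lparr>carrier := H\<rparr>) \<lhd> unitary_group\<lparr>carrier := H\<rparr>"
    (is "?S \<lhd> ?H")
proof -
  interpret group ?H
    using group.subgroup_imp_group[OF unitary_group_is_group assms] .
  have mat_mult: "mat c ** A = A ** mat c" for c :: complex and A :: "complex^2^2"
    by (simp add: mat_def matrix_matrix_mult_def vec_eq_iff sum_2 forall_2)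
  have inv_eq: "x ** inv\<^bsub>?H\<^esub> x = mat 1" "inv\<^bsub>?H\<^esub> x ** x = mat 1" if "x \<in> carrier ?H" for x
    using r_inv[OF that] l_inv[OF that] by (simp_all add: unitary_group_def)
  show ?thesis
    unfolding normal_inv_iff
  proof (intro conjI ballI subgroupI)
    show "?S \<noteq> {}"
      using one_closed by (auto simp: scalar_matrices_def unitary_group_def)
  next
    fix A assume "A \<in> ?S"
    then obtain c where A: "A \<in> carrier ?H" "A = mat c"
      by (auto simp: scalar_matrices_def)
    define B where "B = inv\<^bsub>?H\<^esub> A"
    have "mat c ** B = mat 1"
      using inv_eq(1)[OF A(1)] A(2) by (simp add: B_def)
    then have "c * B $ 1 $ 1 = 1" "c * B $ 2 $ 2 = 1" "c * B $ 1 $ 2 = 0" "c * B $ 2 $ 1 = 0"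
      by (auto simp: mat_def matrix_matrix_mult_def vec_eq_iff sum_2 forall_2)
    then have "B = mat (B $ 1 $ 1)"
      by (auto simp: mat_def vec_eq_iff forall_2)
        (metis mult_cancel_left mult_zero_left zero_neq_one)
    then show "inv\<^bsub>?H\<^esub> A \<in> ?S"
      using inv_closed[OF A(1)] by (auto simp: scalar_matrices_def B_def)
  next
    fix A B assume "A \<in> ?S" "B \<in> ?S"
    then obtain c d where "A \<in> carrier ?H" "B \<in> carrier ?H" "A = mat c" "B = mat d"
      by (auto simp: scalar_matrices_def)
    moreover have "mat c ** mat d = (mat (c * d) :: complex^2^2)"
      by (simp add: mat_def matrix_matrix_mult_def vec_eq_iff sum_2 forall_2)
    ultimately show "A \<otimes>\<^bsub>?H\<^esub> B \<in> ?S"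
      using m_closed[of A B] by (auto simp: scalar_matrices_def unitary_group_def)
  next
    fix x A assume x: "x \<in> carrier ?H" and "A \<in> ?S"
    then obtain c where A: "A \<in> carrier ?H" "A = mat c"
      by (auto simp: scalar_matrices_def)
    have "x ** A ** inv\<^bsub>?H\<^esub> x = mat c ** (x ** inv\<^bsub>?H\<^esub> x)"
      unfolding A(2) by (metis mat_mult matrix_mul_assoc)
    then have "x \<otimes>\<^bsub>?H\<^esub> A \<otimes>\<^bsub>?H\<^esub> inv\<^bsub>?H\<^esub> x = A"
      using inv_eq(1)[OF x] A(2) by (simp add: unitary_group_def)
    then show "x \<otimes>\<^bsub>?H\<^esub> A \<otimes>\<^bsub>?H\<^esub> inv\<^bsub>?H\<^esub> x \<in> ?S"
      using \<open>A \<in> ?S\<close> by simp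
  qed (auto simp: scalar_matrices_def)
qed

end

theory Submission
  imports Defs
begin

text \<open>
  Conjugation by a unitary matrix rotates the three-dimensional space of traceless Hermitian
  matrices spanned by the Pauli matrices \<open>X\<close>, \<open>Y\<close>, \<open>Z\<close>. The generators act there as rotations of
  the cube with vertices \<open>\<plusminus>X \<plusminus> Y \<plusminus> Z\<close>, so every element of \<open>G\<^sub>1\<^sub>1\<close> permutes the four diagonals of
  this cube, and \<open>\<Psi>\<close> is this permutation. A matrix fixing all four diagonals either commutes with
  every traceless matrix, hence is scalar, or maps each of \<open>X\<close>, \<open>Y\<close>, \<open>Z\<close> to its negative, which
  \<open>XY = iZ\<close> excludes. The isomorphisms are then instances of the first isomorphism theorem.
\<close>

text \<open>
  The half-diagonals \<open>aX + bY + Z\<close> with \<open>a, b = \<plusminus>1\<close>. They are numbered such that conjugation by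
  \<open>matR\<close>, which multiplies the upper right entry by \<open>\<i>\<close>, takes the \<open>k\<close>-th to the next one.
\<close>

definition diagonal_reflection :: "nat \<Rightarrow> complex^2^2" where
  "diagonal_reflection k =
     vector [vector [1, \<i> ^ k * (1 - \<i>)], vector [cnj (\<i> ^ k * (1 - \<i>)), -1]]"

text \<open>The conjugation relation has \<open>A\<close> moved to the right-hand side, so it
  involves no inverse and passes to scalar multiples of \<open>A\<close>. The sign is there because
  a diagonal is a line: its half-diagonal may be reversed. Asking for a permutation of
  \<open>{1..4}\<close> also fixes the values of \<open>\<sigma>\<close> outside this set, as in
  \<open>sym_group 4\<close>.\<close>

definition permutes_diagonals :: "complex^2^2 \<Rightarrow> (nat \<Rightarrow> nat) \<Rightarrow> bool" where
  "permutes_diagonals A \<sigma> \<longleftrightarrow> \<sigma> permutes {1..4} \<and>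
     (\<forall>k\<in>{1..4}. \<exists>\<epsilon>\<in>{1, -1 :: real}.
        A ** diagonal_reflection k = \<epsilon> *\<^sub>R (diagonal_reflection (\<sigma> k) ** A))"

text \<open>The description is proper on \<open>G11\<close>: uniqueness holds for every unitary
  matrix, and existence is inherited from the generators.\<close>

definition diagonal_perm :: "complex^2^2 \<Rightarrow> nat \<Rightarrow> nat" where
  "diagonal_perm A = (THE \<sigma>. permutes_diagonals A \<sigma>)"

section \<open>Distinctness of the diagonals and uniqueness of the permutation\<close>

lemma atLeastAtMost_1_4: "{1..4::nat} = {1, 2, 3, 4}"
  by auto

lemma power_i: "\<i> ^ 1 = \<i>" "\<i> ^ 2 = -1" "\<i> ^ 3 = -\<i>" "\<i> ^ 4 = 1"
  by (simp_all add: power3_eq_cube power4_eq_xxxx)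

lemma power_minus_i:
  "(-\<i>) ^ 1 = -\<i>" "(-\<i>) ^ 2 = -1" "(-\<i>) ^ 3 = \<i>" "(-\<i>) ^ 4 = 1"
  by (simp_all add: power3_eq_cube power4_eq_xxxx)

lemma diagonal_reflection_entries:
  "diagonal_reflection k $ 1 $ 1 = 1"
  "diagonal_reflection k $ 1 $ 2 = \<i> ^ k * (1 - \<i>)"
  "diagonal_reflection k $ 2 $ 1 = (-\<i>) ^ k * (1 + \<i>)"
  "diagonal_reflection k $ 2 $ 2 = -1"
  by (simp_all add: diagonal_reflection_def vector_2)

lemma matrix_2_eq_iff:
  "(A :: complex^2^2) = B \<longleftrightarrow>
     A$1$1 = B$1$1 \<and> A$1$2 = B$1$2 \<and> A$2$1 = B$2$1 \<and> A$2$2 = B$2$2"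
  by (auto simp: vec_eq_iff forall_2)

text \<open>The upper left entry is always 1, which rules out the sign -1. The upper right entries
  then give equal powers of \<open>\<i>\<close>, an element of order 4.\<close>

lemma diagonal_reflection_inj:
  assumes "j \<in> {1..4}" "k \<in> {1..4}" "\<epsilon> \<in> {1, -1 :: real}"
    and "diagonal_reflection j = \<epsilon> *\<^sub>R diagonal_reflection k"
  shows "j = k"
proof -
  have "\<epsilon> = 1"
    using assms(3,4) by (auto simp: matrix_2_eq_iff diagonal_reflection_entries)
  then have "\<i> ^ j * (1 - \<i>) = \<i> ^ k * (1 - \<i>)"
    using assms(4) by (metis diagonal_reflection_entries(2) scaleR_one)
  then have "\<i> ^ j = \<i> ^ k"
    by (simp add: complex_eq_iff)
  moreover have "j \<in> {1, 2, 3, 4}" "k \<in> {1, 2, 3, 4}"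
    using assms(1,2) unfolding atLeastAtMost_1_4 .
  ultimately show ?thesis
    by (elim insertE emptyE; simp add: power_i[simplified] complex_eq_iff)
qed

lemma unitary_inverse:
  assumes "A \<in> carrier unitary_group"
  obtains B where "B \<in> carrier unitary_group" "A ** B = mat 1" "B ** A = mat 1"
    "inv\<^bsub>unitary_group\<^esub> A = B"
proof -
  interpret group unitary_group by (rule unitary_group_is_group)
  show ?thesis
    using that[of "inv\<^bsub>unitary_group\<^esub> A"] assms r_inv[OF assms] l_inv[OF assms] inv_closed[OF assms]
    by (simp add: unitary_group_def)
qed

text \<open>Cancelling \<open>A\<close> on the right shows that both candidate images of a diagonal
  agree up to sign, hence have the same index. Outside \<open>{1..4}\<close> both permutations are
  the identity.\<close>

lemma permutes_diagonals_unique: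
  assumes A: "A \<in> carrier unitary_group"
    and "permutes_diagonals A \<sigma>" "permutes_diagonals A \<tau>"
  shows "\<sigma> = \<tau>"
proof
  fix k
  obtain B where B: "A ** B = mat 1"
    using unitary_inverse[OF A] by blast
  show "\<sigma> k = \<tau> k"
  proof (cases "k \<in> {1..4}")
    case True
    obtain \<epsilon> \<delta> where eps: "\<epsilon> \<in> {1, -1}" "\<delta> \<in> {1, -1}"
      "A ** diagonal_reflection k = \<epsilon> *\<^sub>R (diagonal_reflection (\<sigma> k) ** A)"
      "A ** diagonal_reflection k = \<delta> *\<^sub>R (diagonal_reflection (\<tau> k) ** A)"
      using assms(2,3) True unfolding permutes_diagonals_def by meson
    then have "\<epsilon> *\<^sub>R (diagonal_reflection (\<sigma> k) ** A) ** B
        = \<delta> *\<^sub>R (diagonal_reflection (\<tau> k) ** A) ** B"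
      by simp
    then have eq: "\<epsilon> *\<^sub>R diagonal_reflection (\<sigma> k) = \<delta> *\<^sub>R diagonal_reflection (\<tau> k)"
      by (simp flip: scalar_matrix_assoc matrix_mul_assoc add: B)
    have "diagonal_reflection (\<sigma> k) = (\<epsilon> * \<delta>) *\<^sub>R diagonal_reflection (\<tau> k)"
      using arg_cong[OF eq, of "\<lambda>M. \<epsilon> *\<^sub>R M"] eps(1) by auto
    moreover have "\<sigma> k \<in> {1..4}" "\<tau> k \<in> {1..4}"
      using assms(2,3) True permutes_in_image unfolding permutes_diagonals_def by metis+
    moreover have "\<epsilon> * \<delta> \<in> {1, -1}"
      using eps by auto
    ultimately show ?thesis
      using diagonal_reflection_inj by blast
  next
    case False
    then show ?thesis
      using assms(2,3) permutes_not_in unfolding permutes_diagonals_def by metis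
  qed
qed

section \<open>Products, inverses and scalars\<close>

text \<open>Moving the diagonal first past \<open>B\<close> and then past \<open>A\<close>
  multiplies the two signs. The order agrees with composition from right to left, which makes \<Psi>
  a homomorphism.\<close>

lemma permutes_diagonals_mult:
  assumes "permutes_diagonals A \<sigma>" "permutes_diagonals B \<tau>"
  shows "permutes_diagonals (A ** B) (\<sigma> \<circ> \<tau>)"
  unfolding permutes_diagonals_def
proof (intro conjI ballI)
  show "\<sigma> \<circ> \<tau> permutes {1..4}"
    using assms permutes_compose unfolding permutes_diagonals_def by blast
next
  fix k :: nat assume k: "k \<in> {1..4}"
  then obtain \<epsilon> where \<epsilon>: "\<epsilon> \<in> {1, -1}"
    "B ** diagonal_reflection k = \<epsilon> *\<^sub>R (diagonal_reflection (\<tau> k) ** B)"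
    using assms(2) unfolding permutes_diagonals_def by blast
  have "\<tau> k \<in> {1..4}"
    using assms(2) k permutes_in_image unfolding permutes_diagonals_def by metis
  then obtain \<delta> where \<delta>: "\<delta> \<in> {1, -1}"
    "A ** diagonal_reflection (\<tau> k) = \<delta> *\<^sub>R (diagonal_reflection (\<sigma> (\<tau> k)) ** A)"
    using assms(1) unfolding permutes_diagonals_def by blast
  have "A ** B ** diagonal_reflection k = A ** (\<epsilon> *\<^sub>R (diagonal_reflection (\<tau> k) ** B))"
    by (simp add: \<epsilon>(2) flip: matrix_mul_assoc)
  also have "\<dots> = \<epsilon> *\<^sub>R (A ** diagonal_reflection (\<tau> k)) ** B"
    by (simp add: matrix_scalar_ac matrix_mul_assoc flip: scalar_matrix_assoc)
  also have "\<dots> = (\<epsilon> * \<delta>) *\<^sub>R (diagonal_reflection ((\<sigma> \<circ> \<tau>) k) ** (A ** B))"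
    by (simp add: \<delta>(2) matrix_mul_assoc flip: scalar_matrix_assoc)
  finally show "\<exists>\<epsilon>\<in>{1, -1}. A ** B ** diagonal_reflection k
      = \<epsilon> *\<^sub>R (diagonal_reflection ((\<sigma> \<circ> \<tau>) k) ** (A ** B))"
    using \<epsilon>(1) \<delta>(1) by (intro bexI[of _ "\<epsilon> * \<delta>"]) auto
qed

lemma permutes_diagonals_inv:
  assumes "permutes_diagonals A \<sigma>" "A ** B = mat 1" "B ** A = mat 1"
  shows "permutes_diagonals B (inv' \<sigma>)"
  unfolding permutes_diagonals_def
proof (intro conjI ballI)
  have \<sigma>: "\<sigma> permutes {1..4}"
    using assms(1) unfolding permutes_diagonals_def by blast
  then show "inv' \<sigma> permutes {1..4}"
    by (rule permutes_inv)
  fix j :: nat assume "j \<in> {1..4}"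
  define k where "k = inv' \<sigma> j"
  have k: "k \<in> {1..4}" "\<sigma> k = j"
    unfolding k_def using \<open>j \<in> _\<close> \<sigma> permutes_in_image[OF permutes_inv[OF \<sigma>]]
    by (simp_all only: permutes_inverses)
  then obtain \<epsilon> where \<epsilon>: "\<epsilon> \<in> {1, -1}"
    "A ** diagonal_reflection k = \<epsilon> *\<^sub>R (diagonal_reflection j ** A)"
    using assms(1) unfolding permutes_diagonals_def by blast
  have "diagonal_reflection k ** B = B ** (A ** diagonal_reflection k) ** B"
    by (simp add: matrix_mul_assoc assms)
  also have "\<dots> = \<epsilon> *\<^sub>R (B ** diagonal_reflection j ** (A ** B))"
    by (simp add: \<epsilon>(2) matrix_scalar_ac matrix_mul_assoc flip: scalar_matrix_assoc)
  \<comment> \<open>The sign changes sides because its square is 1.\<close>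
  finally have "B ** diagonal_reflection j = \<epsilon> *\<^sub>R (diagonal_reflection k ** B)"
    using \<epsilon>(1) by (auto simp: assms)
  then show "\<exists>\<epsilon>\<in>{1, -1}. B ** diagonal_reflection j
      = \<epsilon> *\<^sub>R (diagonal_reflection (inv' \<sigma> j) ** B)"
    using \<epsilon>(1) k_def by blast
qed

lemma mat_scalar_commute: "mat c ** A = A ** mat c" for c :: complex and A :: "complex^2^2"
  by (simp add: mat_def matrix_matrix_mult_def vec_eq_iff sum_2 forall_2)

text \<open>Besides giving one half of the kernel, this allows the factor \<open>1 / sqrt 2\<close>
  of \<open>matF\<close> and the root of unity in \<open>matZ\<close> to be dropped.\<close>

lemma permutes_diagonals_scalar: "permutes_diagonals (mat c) id"
  by (auto simp: permutes_diagonals_def mat_scalar_commute permutes_id)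

section \<open>Permutations of the three generators\<close>

lemma matrix_mult_2:
  fixes A B :: "complex^2^2"
  shows "(A ** B) $ i $ j = A $ i $ 1 * B $ 1 $ j + A $ i $ 2 * B $ 2 $ j"
  by (simp add: matrix_matrix_mult_def sum_2)

lemma permutes_diagonalsI:
  assumes "\<sigma> permutes {1..4}"
    and "A ** diagonal_reflection 1 = \<epsilon>\<^sub>1 *\<^sub>R (diagonal_reflection (\<sigma> 1) ** A)"
    and "A ** diagonal_reflection 2 = \<epsilon>\<^sub>2 *\<^sub>R (diagonal_reflection (\<sigma> 2) ** A)"
    and "A ** diagonal_reflection 3 = \<epsilon>\<^sub>3 *\<^sub>R (diagonal_reflection (\<sigma> 3) ** A)"
    and "A ** diagonal_reflection 4 = \<epsilon>\<^sub>4 *\<^sub>R (diagonal_reflection (\<sigma> 4) ** A)"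
    and "{\<epsilon>\<^sub>1, \<epsilon>\<^sub>2, \<epsilon>\<^sub>3, \<epsilon>\<^sub>4} \<subseteq> {1, -1}"
  shows "permutes_diagonals A \<sigma>"
  using assms unfolding permutes_diagonals_def atLeastAtMost_1_4 by blast

text \<open>Conjugation by \<open>matF\<close> exchanges X and Z and negates Y. It thus exchanges
  the half-diagonals 1 and 4 and reverses 2 and 3, whence the signs.\<close>

lemma permutes_diagonals_F: "permutes_diagonals matF (cycle_of_list [1, 4])"
proof -
  \<comment> \<open>Without the factor \<open>1 / sqrt 2\<close> the entrywise check involves only
    Gaussian integers.\<close>
  define M :: "complex^2^2" where "M = vector [vector [1, 1], vector [1, -1]]"
  have cycle: "cycle_of_list [1, 4::nat] permutes {1..4}"
    by (rule permutes_subset[OF cycle_permutes]) auto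
  have "permutes_diagonals M (cycle_of_list [1, 4])"
    by (rule permutes_diagonalsI[OF cycle,
          where \<epsilon>\<^sub>1 = 1 and \<epsilon>\<^sub>2 = "-1" and \<epsilon>\<^sub>3 = "-1" and \<epsilon>\<^sub>4 = 1])
      (simp_all add: M_def matrix_2_eq_iff matrix_mult_2 diagonal_reflection_entries vector_2
        power_i[simplified] power_minus_i[simplified] complex_eq_iff Transposition.transpose_def)
  moreover have "matF = mat (of_real (1 / sqrt 2)) ** M"
    by (simp add: matF_def M_def matrix_2_eq_iff matrix_mult_2 mat_def vector_2
        scaleR_conv_of_real[where 'a = complex])
  ultimately show ?thesis
    using permutes_diagonals_mult[OF permutes_diagonals_scalar] by (metis id_comp)
qed

text \<open>This is a quarter turn about the Z axis. All four half-diagonals have Z-coefficient 1,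
  so no sign occurs.\<close>

lemma permutes_diagonals_R: "permutes_diagonals matR (cycle_of_list [1, 2, 3, 4])"
proof -
  have cycle: "cycle_of_list [1, 2, 3, 4::nat] permutes {1..4}"
    by (rule permutes_subset[OF cycle_permutes]) auto
  show ?thesis
    by (rule permutes_diagonalsI[OF cycle,
          where \<epsilon>\<^sub>1 = 1 and \<epsilon>\<^sub>2 = 1 and \<epsilon>\<^sub>3 = 1 and \<epsilon>\<^sub>4 = 1])
      (simp_all add: matR_def matrix_2_eq_iff matrix_mult_2 diagonal_reflection_entries vector_2
        power_i[simplified] power_minus_i[simplified] complex_eq_iff Transposition.transpose_def)
qed

text \<open>\<open>matZ\<close> is a scalar times \<open>matR ** matF\<close>, so its permutation is
  (1 2 3 4)(1 4) with the right factor applied first.\<close>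

lemma permutes_diagonals_Z: "permutes_diagonals matZ (cycle_of_list [2, 3, 4])"
proof -
  have "cycle_of_list [2, 3, 4::nat] = id \<circ> (cycle_of_list [1, 2, 3, 4] \<circ> cycle_of_list [1, 4])"
    by (auto simp: fun_eq_iff Transposition.transpose_def)
  then show ?thesis
    unfolding matZ_def
    using permutes_diagonals_mult permutes_diagonals_scalar permutes_diagonals_F
      permutes_diagonals_R by metis
qed

section \<open>Matrices fixing every diagonal\<close>

text \<open>For each diagonal, \<open>A\<close> either commutes or anticommutes with its matrix.
  Diagonals with upper right entries \<open>w\<close> and \<open>-w\<close> are compared first;
  unless \<open>A\<close> is scalar, it anticommutes with both. If this happens for both such pairs,
  then \<open>A\<close> is zero, which is again of the form \<open>mat c\<close>.\<close>

lemma permutes_diagonals_id_imp_scalar: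
  assumes A: "A \<in> carrier unitary_group" and "permutes_diagonals A id"
  shows "\<exists>c. A = mat c"
proof -
  define p q r s where pqrs: "p = A$1$1" "q = A$1$2" "r = A$2$1" "s = A$2$2"
  \<comment> \<open>The first alternative is the sign 1 (commuting), the second the sign -1
    (anticommuting), read off from the entries.\<close>
  have rel: "(q * cnj w = w * r \<and> (p - s) * w = 2 * q \<and> (p - s) * cnj w = 2 * r) \<or>
      (s = - p \<and> 2 * p + q * cnj w + w * r = 0)"
    if "k \<in> {1..4}" and w: "w = \<i> ^ k * (1 - \<i>)" for k w
  proof -
    have D: "diagonal_reflection k = vector [vector [1, w], vector [cnj w, -1]]"
      by (simp only: diagonal_reflection_def w)
    have "1 - \<i> \<noteq> 0"
      by (simp add: complex_eq_iff)
    then have "w \<noteq> 0"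
      by (simp add: w)
    have "\<exists>\<epsilon>\<in>{1, -1 :: real}.
        A ** diagonal_reflection k = \<epsilon> *\<^sub>R (diagonal_reflection k ** A)"
      using assms(2) that(1) by (simp only: permutes_diagonals_def id_apply)
    then obtain \<epsilon> where "\<epsilon> \<in> {1, -1 :: real}"
      and eq: "A ** diagonal_reflection k = \<epsilon> *\<^sub>R (diagonal_reflection k ** A)"
      by (rule bexE)
    have entry: "(A ** diagonal_reflection k) $ i $ j = \<epsilon> *\<^sub>R (diagonal_reflection k ** A) $ i $ j"
      for i j
      using eq by simp
    have "p + q * cnj w = of_real \<epsilon> * (p + w * r)" "p * w - q = of_real \<epsilon> * (q + w * s)"
      "r + s * cnj w = of_real \<epsilon> * (cnj w * p - r)"
      using entry[of 1 1] entry[of 1 2] entry[of 2 1]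
      by (simp_all only: matrix_mult_2 D vector_2 scaleR_conv_of_real mult_1 mult_1_right
          mult_minus1 mult_minus1_right add_uminus_conv_diff flip: pqrs)
    note entries = this
    show ?thesis
    proof cases
      assume "\<epsilon> = 1"
      then have "q * cnj w = w * r" and e: "p * w - q = q + w * s" "r + s * cnj w = cnj w * p - r"
        using entries by simp_all
      moreover have "(p - s) * w = (p * w - q) - w * s + q"
        by (simp add: algebra_simps)
      then have "(p - s) * w = 2 * q"
        unfolding e(1) by simp
      moreover have "(p - s) * cnj w = (cnj w * p - r) - s * cnj w + r"
        by (simp add: algebra_simps)
      then have "(p - s) * cnj w = 2 * r"
        unfolding e(2)[symmetric] by simp
      ultimately show ?thesis by blast
    next
      assume "\<epsilon> \<noteq> 1"
      then have "\<epsilon> = -1"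
        using \<open>\<epsilon> \<in> _\<close> by auto
      then have e: "p + q * cnj w = - (p + w * r)" "p * w - q = - (q + w * s)"
        using entries by simp_all
      have "(p + s) * w = (p * w - q) + (q + w * s)"
        by (simp add: algebra_simps)
      then have "(p + s) * w = 0"
        unfolding e(2) by simp
      then have "s = -p"
        using \<open>w \<noteq> 0\<close> by (simp add: add_eq_0_iff2)
      moreover have "2 * p + q * cnj w + w * r = (p + q * cnj w) + (p + w * r)"
        by simp
      then have "2 * p + q * cnj w + w * r = 0"
        unfolding e(1) by simp
      ultimately show ?thesis by blast
    qed
  qed
  \<comment> \<open>The norm condition is |1 - i|^2 = 2; indices of opposite entries differ by
    2.\<close>
  have pair: "(q = 0 \<and> r = 0 \<and> p = s) \<or> (p = 0 \<and> s = 0 \<and> q * cnj w + w * r = 0)"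
    if w: "w * cnj w = 2"
      and k: "j \<in> {1..4}" "w = \<i> ^ j * (1 - \<i>)" "k \<in> {1..4}" "-w = \<i> ^ k * (1 - \<i>)"
    for w j k
  proof -
    \<comment> \<open>Opposite signs on the two diagonals: \<open>A\<close> commutes for the entry
      \<open>v\<close> and anticommutes for \<open>-v\<close>. Then \<open>q = p * v\<close> and
      \<open>r = p * cnj v\<close> turn the fourth equation into 2p = 4p, so all entries
      vanish.\<close>
    have mixed: "q = 0 \<and> r = 0 \<and> p = s"
      if "(p - s) * v = 2 * q" "(p - s) * cnj v = 2 * r" "s = -p"
        "2 * p = q * cnj v + v * r" "v * cnj v = 2" for v
    proof -
      have "p - s = 2 * p"
        using that(3) by simp
      then have q: "q = p * v" and r: "r = p * cnj v"
        using that(1,2) by (simp_all only: mult.assoc mult_left_cancel[OF zero_neq_numeral[symmetric]])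
      have "q * cnj v + v * r = 2 * (p * (v * cnj v))"
        unfolding q r by simp
      then have "p = 0"
        using that(4,5) by simp
      then show ?thesis
        using q r that(3) by simp
    qed
    have w': "-w * cnj (-w) = 2"
      using w by simp
    consider
      (both_plus) "(p - s) * w = 2 * q" "(p - s) * (-w) = 2 * q" "(p - s) * cnj w = 2 * r"
        "(p - s) * cnj (-w) = 2 * r"
      | (plus_minus) "(p - s) * w = 2 * q" "(p - s) * cnj w = 2 * r" "s = -p"
        "2 * p + q * cnj (-w) + -w * r = 0"
      | (minus_plus) "(p - s) * -w = 2 * q" "(p - s) * cnj (-w) = 2 * r" "s = -p"
        "2 * p + q * cnj w + w * r = 0"
      | (both_minus) "s = -p" "2 * p + q * cnj w + w * r = 0" "2 * p + q * cnj (-w) + -w * r = 0"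
      using rel[OF k(1,2)] rel[OF k(3,4)] by argo
    then show ?thesis
    proof cases
      case both_plus
      then have "q = 0" "r = 0"
        by simp_all
      moreover have "w \<noteq> 0"
        using w by auto
      ultimately show ?thesis
        using both_plus(1) by simp
    next
      case plus_minus
      have "2 * p = (2 * p + q * cnj (-w) + -w * r) + (q * cnj w + w * r)"
        by simp
      then have "2 * p = q * cnj w + w * r"
        unfolding plus_minus(4) by simp
      then show ?thesis
        using mixed[OF plus_minus(1-3) _ w] by blast
    next
      case minus_plus
      have "2 * p = (2 * p + q * cnj w + w * r) + (q * cnj (-w) + -w * r)"
        by simp
      then have "2 * p = q * cnj (-w) + -w * r"
        unfolding minus_plus(4) by simp
      then show ?thesis
        using mixed[OF minus_plus(1-3) _ w'] by blast
    next
      case both_minus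
      have "4 * p = (2 * p + q * cnj w + w * r) + (2 * p + q * cnj (-w) + -w * r)"
        by simp
      then have "p = 0"
        unfolding both_minus(2,3) by simp
      then show ?thesis
        using both_minus by simp
    qed
  qed
  have "q = 0 \<and> r = 0 \<and> p = s"
  proof -
    have "(q = 0 \<and> r = 0 \<and> p = s) \<or> (p = 0 \<and> s = 0 \<and> q * cnj (1 + \<i>) + (1 + \<i>) * r = 0)"
      by (rule pair[of _ 1 3]) (simp_all add: power_i[simplified] algebra_simps)
    moreover have "(q = 0 \<and> r = 0 \<and> p = s) \<or> (p = 0 \<and> s = 0 \<and> q * cnj (1 - \<i>) + (1 - \<i>) * r = 0)"
      by (rule pair[of _ 4 2]) (simp_all add: power_i[simplified] algebra_simps)
    \<comment> \<open>If both second alternatives hold, q and r solve a homogeneous linear system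
      with determinant (1 - i)^2 - (1 + i)^2 = -4i, so they vanish too.\<close>
    ultimately show ?thesis
      by (auto simp: complex_eq_iff)
  qed
  then have "A = mat p"
    by (simp add: matrix_2_eq_iff mat_def pqrs)
  then show ?thesis ..
qed

section \<open>The homomorphism and its kernel\<close>

lemma G11_subset_unitary: "carrier G11 \<subseteq> carrier unitary_group"
  unfolding carrier_G11
  using group.generate_incl[OF unitary_group_is_group] generators_unitary .

text \<open>Since \<open>G11\<close> is generated by three matrices, this reduces the existence of a
  permutation for each of its elements to those three.\<close>

lemma permutes_diagonals_subgroup:
  "subgroup {A \<in> carrier unitary_group. \<exists>\<sigma>. permutes_diagonals A \<sigma>} unitary_group"
proof -
  interpret group unitary_group by (rule unitary_group_is_group)
  show ?thesis
  proof (rule subgroupI)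
    show "{A \<in> carrier unitary_group. \<exists>\<sigma>. permutes_diagonals A \<sigma>} \<noteq> {}"
      using one_closed permutes_diagonals_scalar[of 1]
      by (metis (mono_tags, lifting) empty_iff mem_Collect_eq monoid.select_convs(2)
          unitary_group_def)
  next
    fix A assume "A \<in> {A \<in> carrier unitary_group. \<exists>\<sigma>. permutes_diagonals A \<sigma>}"
    then show "inv\<^bsub>unitary_group\<^esub> A \<in> {A \<in> carrier unitary_group. \<exists>\<sigma>. permutes_diagonals A \<sigma>}"
      using unitary_inverse[of A] permutes_diagonals_inv by (smt (verit) mem_Collect_eq)
  next
    fix A B assume "A \<in> {A \<in> carrier unitary_group. \<exists>\<sigma>. permutes_diagonals A \<sigma>}"
      "B \<in> {A \<in> carrier unitary_group. \<exists>\<sigma>. permutes_diagonals A \<sigma>}"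
    then show "A \<otimes>\<^bsub>unitary_group\<^esub> B \<in> {A \<in> carrier unitary_group. \<exists>\<sigma>. permutes_diagonals A \<sigma>}"
      using m_closed[of A B] permutes_diagonals_mult[of A _ B] by (auto simp: unitary_group_def)
  qed auto
qed

lemma diagonal_perm_eqI:
  assumes "A \<in> carrier G11" "permutes_diagonals A \<sigma>"
  shows "diagonal_perm A = \<sigma>"
  unfolding diagonal_perm_def
  using assms G11_subset_unitary permutes_diagonals_unique by (intro the_equality) blast+

lemma permutes_diagonal_perm:
  assumes "A \<in> carrier G11"
  shows "permutes_diagonals A (diagonal_perm A)"
proof -
  have "carrier G11 \<subseteq> {A \<in> carrier unitary_group. \<exists>\<sigma>. permutes_diagonals A \<sigma>}"
    unfolding carrier_G11
    using generators_unitary permutes_diagonals_F permutes_diagonals_R permutes_diagonals_Z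
    by (intro group.generate_subgroup_incl[OF unitary_group_is_group _ permutes_diagonals_subgroup])
      auto
  then obtain \<sigma> where "permutes_diagonals A \<sigma>"
    using assms by blast
  with diagonal_perm_eqI[OF assms] show ?thesis by metis
qed

lemma mult_G11: "A \<otimes>\<^bsub>G11\<^esub> B = A ** B"
  by (simp add: G11_def subgroup_generated_def unitary_group_def)

lemma diagonal_perm_hom: "diagonal_perm \<in> hom G11 (sym_group 4)"
proof (rule homI)
  fix A assume "A \<in> carrier G11"
  then show "diagonal_perm A \<in> carrier (sym_group 4)"
    using permutes_diagonal_perm by (auto simp: sym_group_carrier permutes_diagonals_def)
next
  fix A B assume AB: "A \<in> carrier G11" "B \<in> carrier G11"
  then have "A ** B \<in> carrier G11"
    using monoid.m_closed[OF group.is_monoid[OF G11_is_group]] by (metis mult_G11)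
  then show "diagonal_perm (A \<otimes>\<^bsub>G11\<^esub> B) = diagonal_perm A \<otimes>\<^bsub>sym_group 4\<^esub> diagonal_perm B"
    using AB by (simp add: mult_G11 sym_group_mult diagonal_perm_eqI permutes_diagonals_mult
        permutes_diagonal_perm)
qed

lemma diagonal_perm_group_hom: "group_hom G11 (sym_group 4) diagonal_perm"
  using diagonal_perm_hom G11_is_group sym_group_is_group
  by (simp add: group_hom_def group_hom_axioms_def)

text \<open>This identifies the kernel of \<Psi> with the scalar matrices, the subgroup factored out
  in the collineation group.\<close>

lemma diagonal_perm_eq_id_iff:
  assumes "A \<in> carrier G11"
  shows "diagonal_perm A = id \<longleftrightarrow> (\<exists>c. A = mat c)"
proof
  assume "diagonal_perm A = id"
  then have "permutes_diagonals A id"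
    using permutes_diagonal_perm[OF assms] by simp
  then show "\<exists>c. A = mat c"
    using permutes_diagonals_id_imp_scalar assms G11_subset_unitary by blast
next
  assume "\<exists>c. A = mat c"
  then have "permutes_diagonals A id"
    using permutes_diagonals_scalar by auto
  then show "diagonal_perm A = id"
    by (rule diagonal_perm_eqI[OF assms])
qed

lemma diagonal_perm_generators:
  "diagonal_perm matF = cycle_of_list [1, 4]"
  "diagonal_perm matR = cycle_of_list [1, 2, 3, 4]"
  "diagonal_perm matZ = cycle_of_list [2, 3, 4]"
  and generators_G11: "matF \<in> carrier G11" "matR \<in> carrier G11" "matZ \<in> carrier G11"
proof -
  show "matF \<in> carrier G11" "matR \<in> carrier G11" "matZ \<in> carrier G11"
    by (auto simp: carrier_G11 intro: generate.incl)
  then show "diagonal_perm matF = cycle_of_list [1, 4]"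
    "diagonal_perm matR = cycle_of_list [1, 2, 3, 4]"
    "diagonal_perm matZ = cycle_of_list [2, 3, 4]"
    using diagonal_perm_eqI permutes_diagonals_F permutes_diagonals_R permutes_diagonals_Z
    by blast+
qed

section \<open>Generation of the symmetric group and surjectivity\<close>

lemma fun_eq_4I:
  fixes f g :: "nat \<Rightarrow> 'a"
  assumes "f 1 = g 1" "f 2 = g 2" "f 3 = g 3" "f 4 = g 4"
    and "\<And>x. x \<notin> {1, 2, 3, 4} \<Longrightarrow> f x = g x"
  shows "f = g"
  using assms by (metis ext insert_iff empty_iff)

text \<open>Conjugating (1 4) by the 4-cycle yields (1 2), (2 3) and (3 4) in turn. Conjugating
  these among themselves yields the remaining transpositions, and transpositions generate the
  group.\<close>

lemma sym_group_4_generated: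
  assumes K: "subgroup K (sym_group 4)"
    and gen: "cycle_of_list [1, 4] \<in> K" "cycle_of_list [1, 2, 3, 4] \<in> K"
  shows "K = carrier (sym_group 4)"
proof
  show "K \<subseteq> carrier (sym_group 4)"
    using K by (rule subgroup.subset)
  let ?t = "Transposition.transpose :: nat \<Rightarrow> _"
  let ?c = "cycle_of_list [1, 2, 3, 4::nat]"
  have comp: "\<sigma> \<circ> \<tau> \<in> K" if "\<sigma> \<in> K" "\<tau> \<in> K" for \<sigma> \<tau>
    using subgroup.m_closed[OF K that] by (simp add: sym_group_mult)
  have t14: "?t 1 4 \<in> K"
    using gen(1) by simp
  \<comment> \<open>The cube of the 4-cycle serves as its inverse, so closure under composition
    suffices.\<close>
  have "?t 1 2 = ?c \<circ> (?t 1 4 \<circ> (?c \<circ> (?c \<circ> ?c)))"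
    by (rule fun_eq_4I; simp add: Transposition.transpose_def)+
  then have t12: "?t 1 2 \<in> K"
    by (simp only:) (intro comp gen(2) t14)
  have "?t 2 3 = ?c \<circ> (?t 1 2 \<circ> (?c \<circ> (?c \<circ> ?c)))"
    by (rule fun_eq_4I; simp add: Transposition.transpose_def)+
  then have t23: "?t 2 3 \<in> K"
    by (simp only:) (intro comp gen(2) t12)
  have "?t 3 4 = ?c \<circ> (?t 2 3 \<circ> (?c \<circ> (?c \<circ> ?c)))"
    by (rule fun_eq_4I; simp add: Transposition.transpose_def)+
  then have t34: "?t 3 4 \<in> K"
    by (simp only:) (intro comp gen(2) t23)
  have "?t 1 3 = ?t 1 2 \<circ> (?t 2 3 \<circ> ?t 1 2)"
    "?t 2 4 = ?t 2 3 \<circ> (?t 3 4 \<circ> ?t 2 3)"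
    by (rule fun_eq_4I; simp add: Transposition.transpose_def)+
  then have t13: "?t 1 3 \<in> K" and t24: "?t 2 4 \<in> K"
    using comp t12 t23 t34 by metis+
  have trans: "?t a b \<in> K" if "a \<in> {1..4}" "b \<in> {1..4}" "a \<noteq> b" for a b
    using that t12 t13 t14 t23 t24 t34 unfolding atLeastAtMost_1_4
    by (auto simp: transpose_commute)
  show "carrier (sym_group 4) \<subseteq> K"
  proof
    fix \<sigma> assume "\<sigma> \<in> carrier (sym_group 4)"
    then have "\<sigma> permutes {1..4}"
      by (simp add: sym_group_carrier)
    then show "\<sigma> \<in> K"
      using finite_atLeastAtMost
    proof (induction rule: permutes_induct)
      case id
      show ?case
        using subgroup.one_closed[OF K] by (simp only: sym_group_one)
    next
      case (swap a b \<sigma>)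
      then show ?case
        using comp trans by blast
    qed
  qed
qed

text \<open>The image is a subgroup containing (1 4) and (1 2 3 4), the images of
  \<open>matF\<close> and \<open>matR\<close>.\<close>

lemma diagonal_perm_surj: "diagonal_perm ` carrier G11 = carrier (sym_group 4)"
proof (rule sym_group_4_generated)
  show "subgroup (diagonal_perm ` carrier G11) (sym_group 4)"
    using group_hom.img_is_subgroup[OF diagonal_perm_group_hom] .
qed (use diagonal_perm_generators generators_G11 in \<open>metis imageI\<close>)+

section \<open>Collineation groups of subgroups\<close>

text \<open>Cutting the codomain down to the image of \<open>H\<close> makes the restriction
  surjective and keeps the same unit, so the kernel is still given by the scalar matrices.\<close>

lemma diagonal_perm_restrict_kernel:
  assumes "subgroup H G11"
  shows "kernel (G11\<lparr>carrier := H\<rparr>) ((sym_group 4)\<lparr>carrier := diagonal_perm ` H\<rparr>) diagonal_perm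
    = scalar_matrices (G11\<lparr>carrier := H\<rparr>)"
  using subgroup.subset[OF assms] diagonal_perm_eq_id_iff
  by (auto simp: kernel_def scalar_matrices_def sym_group_one)

lemma diagonal_perm_restrict_group_hom:
  assumes "subgroup H G11"
  shows "group_hom (G11\<lparr>carrier := H\<rparr>) ((sym_group 4)\<lparr>carrier := diagonal_perm ` H\<rparr>) diagonal_perm"
proof -
  interpret group_hom G11 "sym_group 4" diagonal_perm
    by (rule diagonal_perm_group_hom)
  show ?thesis
    using G.subgroup_imp_group[OF assms]
      H.subgroup_imp_group[OF subgroup_img_is_subgroup[OF assms]]
      hom_mult subgroup.mem_carrier[OF assms]
    by (auto simp: group_hom_def group_hom_axioms_def hom_def)
qed

text \<open>This is the first isomorphism theorem for the restriction to \<open>H\<close>;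
  \<open>the_elem\<close> extracts the common value of \<Psi> on a coset.\<close>

lemma collineation_group_subgroup_iso:
  assumes "subgroup H G11"
  shows "(\<lambda>C. the_elem (diagonal_perm ` C)) \<in>
    iso (collineation_group (G11\<lparr>carrier := H\<rparr>)) ((sym_group 4)\<lparr>carrier := diagonal_perm ` H\<rparr>)"
  using group_hom.FactGroup_iso_set[OF diagonal_perm_restrict_group_hom[OF assms]]
  by (simp add: diagonal_perm_restrict_kernel[OF assms] collineation_group_def)

text \<open>\<Psi> is constant on cosets of its kernel. This shows that the isomorphism obtained is
  the one induced by \<Psi>.\<close>

lemma the_elem_image_scalar_coset:
  assumes "A \<in> carrier G11"
  shows "the_elem (diagonal_perm ` (scalar_matrices G11 #>\<^bsub>G11\<^esub> A)) = diagonal_perm A"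
proof -
  interpret group_hom G11 "sym_group 4" diagonal_perm
    by (rule diagonal_perm_group_hom)
  have const: "diagonal_perm (S \<otimes>\<^bsub>G11\<^esub> A) = diagonal_perm A" if "S \<in> scalar_matrices G11" for S
    using that assms diagonal_perm_eq_id_iff[of S]
    by (auto simp: scalar_matrices_def sym_group_mult simp del: ex_simps)
  \<comment> \<open>The coset must be nonempty for its image to be a singleton.\<close>
  have one: "\<one>\<^bsub>G11\<^esub> \<in> scalar_matrices G11"
    using G.one_closed by (auto simp: scalar_matrices_def G11_def subgroup_generated_def unitary_group_def)
  have "diagonal_perm ` (scalar_matrices G11 #>\<^bsub>G11\<^esub> A)
      = (\<lambda>S. diagonal_perm (S \<otimes>\<^bsub>G11\<^esub> A)) ` scalar_matrices G11"
    by (auto simp: r_coset_def)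
  also have "\<dots> = (\<lambda>_. diagonal_perm A) ` scalar_matrices G11"
    using const by (rule image_cong[OF refl])
  also have "\<dots> = {diagonal_perm A}"
    using one by blast
  finally have "diagonal_perm ` (scalar_matrices G11 #>\<^bsub>G11\<^esub> A) = {diagonal_perm A}" .
  then show ?thesis by simp
qed

theorem lemma4p1:
  shows "\<exists>\<Psi>. \<Psi> \<in> epi G11 (sym_group 4) \<and>
    \<Psi> matF = cycle_of_list [1, 4] \<and>
    \<Psi> matR = cycle_of_list [1, 2, 3, 4] \<and>
    \<Psi> matZ = cycle_of_list [2, 3, 4] \<and>
    (\<exists>\<Phi> \<in> iso (collineation_group G11) (sym_group 4).
       \<forall>A \<in> carrier G11. \<Phi> (scalar_matrices G11 #>\<^bsub>G11\<^esub> A) = \<Psi> A) \<and>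
    (\<forall>H. subgroup H G11 \<longrightarrow>
       collineation_group (G11\<lparr>carrier := H\<rparr>) \<cong> (sym_group 4)\<lparr>carrier := \<Psi> ` H\<rparr>)"
proof (intro exI[of _ diagonal_perm] conjI diagonal_perm_generators allI impI)
  show "diagonal_perm \<in> epi G11 (sym_group 4)"
    using diagonal_perm_hom diagonal_perm_surj by (simp add: epi_def)
  \<comment> \<open>This is the case of the whole group, where surjectivity turns the image into all
    of \<open>sym_group 4\<close>.\<close>
  have "(\<lambda>C. the_elem (diagonal_perm ` C)) \<in> iso (collineation_group G11) (sym_group 4)"
    using collineation_group_subgroup_iso[OF group.subgroup_self[OF G11_is_group]]
    by (simp add: diagonal_perm_surj)
  then show "\<exists>\<Phi> \<in> iso (collineation_group G11) (sym_group 4).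
      \<forall>A \<in> carrier G11. \<Phi> (scalar_matrices G11 #>\<^bsub>G11\<^esub> A) = diagonal_perm A"
    by (rule bexI[rotated]) (simp add: the_elem_image_scalar_coset)
  fix H assume "subgroup H G11"
  then show "collineation_group (G11\<lparr>carrier := H\<rparr>)
      \<cong> (sym_group 4)\<lparr>carrier := diagonal_perm ` H\<rparr>"
    using collineation_group_subgroup_iso by (auto simp: is_iso_def)
qed

end
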